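(* Let $N>k\ge 3$ be integers. Every totally isotropic subspace of $W_N$ of (projective) dimension $k$ is positive, i.e. the matrix product of all the $N$-qubit observables corresponding to its points equals $I^{\otimes N}$. Consequently, the quantum configuration whose observables are all the points of $W_N$ and whose contexts are all the totally isotropic subspaces of $W_N$ of dimension $k$ is non-contextual.
   Context: $W_N=\mathcal{W}(2N-1,2)$ is the symplectic polar space on $\mathbb{F}_2^{2N}$ with symplectic form $\langle x|y\rangle=\sum_{i=1}^N (x_iy_{N+i}+x_{N+i}y_i)$. Its points are the nonzero vectors of $\mathbb{F}_2^{2N}$. A totally isotropic subspace of $W_N$ of (projective) dimension $k$ is a vector subspace of $\mathbb{F}_2^{2N}$ of dimension $k+1$ on which the form vanishes identically, with its zero vector removed. Let $I$ be the $2\times2$ identity matrix and $X=\begin{pmatrix}0&1\\1&0\end{pmatrix}$, $Y=\begin{pmatrix}0&-\mathrm{i}\\ \mathrm{i}&0\end{pmatrix}$, $Z=\begin{pmatrix}1&0\\0&-1\end{pmatrix}$. A point $(g_1,\dots,g_{2N})$ is identified with the (phase-free) $N$-qubit observable $G_1\otimes\cdots\otimes G_N$, $G_j\in\{I,X,Y,Z\}$, where $(g_j,g_{j+N})=(0,0),(0,1),(1,1),(1,0)$ corresponds to $G_j=I,X,Y,Z$ respectively. Two observables commute iff their vectors are orthogonal for the symplectic form, so the product of the observables of a totally isotropic subspace does not depend on the order. A quantum configuration is a pair $(O,C)$, with $O$ a finite set of observables and $C$ a finite set of subsets of $O$ (contexts), such that each $M\in O$ satisfies $M^2=I^{\otimes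 N}$, observables in the same context commute, and the matrix product of all observables of each context is $I^{\otimes N}$ (positive context) or $-I^{\otimes N}$ (negative context). Its incidence matrix $A\in\mathbb{F}_2^{|C|\times|O|}$ has $A_{i,j}=1$ iff the $i$-th context contains the $j$-th observable; its valuation vector $E\in\mathbb{F}_2^{|C|}$ has $E_i=0$ if the $i$-th context is positive and $E_i=1$ if it is negative. The configuration is contextual iff $Ax=E$ has no solution $x\in\mathbb{F}_2^{|O|}$, and non-contextual otherwise. *)

theory Defs
  imports
    "Jordan_Normal_Form.VS_Connect"
    "Jordan_Normal_Form.Schur_Decomposition"
    "HOL-Library.Z2"
begin

section \<open>The symplectic polar space over the field with two elements\<close>

text \<open>Coordinates are numbered from \<open>0\<close>, so the \<open>j\<close>-th qubit (\<open>j < N\<close>) is described by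
  the coordinates \<open>j\<close> and \<open>N + j\<close>.\<close>

definition symp_form :: "nat \<Rightarrow> bit vec \<Rightarrow> bit vec \<Rightarrow> bit" where
  "symp_form N x y = (\<Sum>i<N. x $ i * y $ (N + i) + x $ (N + i) * y $ i)"

definition points :: "nat \<Rightarrow> bit vec set" where
  "points N = carrier_vec (2 * N) - {0\<^sub>v (2 * N)}"

text \<open>The parameter \<open>k\<close> is the projective dimension; the zero vector is removed.\<close>

definition totally_isotropic_subspace :: "nat \<Rightarrow> nat \<Rightarrow> bit vec set \<Rightarrow> bool" where
  "totally_isotropic_subspace N k S \<longleftrightarrow>
    (\<exists>U. VectorSpace.subspace class_ring U (module_vec TYPE(bit) (2 * N)) \<and>
         vectorspace.dim class_ring ((module_vec TYPE(bit) (2 * N))\<lparr>carrier := U\<rparr>) = k + 1 \<and>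
         (\<forall>x\<in>U. \<forall>y\<in>U. symp_form N x y = 0) \<and>
         S = U - {0\<^sub>v (2 * N)})"


section \<open>Multi-qubit observables\<close>

definition pauli_X :: "complex mat" where
  "pauli_X = mat_of_rows_list 2 [[0, 1], [1, 0]]"

definition pauli_Y :: "complex mat" where
  "pauli_Y = mat_of_rows_list 2 [[0, - \<i>], [\<i>, 0]]"

definition pauli_Z :: "complex mat" where
  "pauli_Z = mat_of_rows_list 2 [[1, 0], [0, - 1]]"

definition pauli :: "bit \<Rightarrow> bit \<Rightarrow> complex mat" where
  "pauli a b =
    (if a = 0 then (if b = 0 then 1\<^sub>m 2 else pauli_X)
     else (if b = 0 then pauli_Z else pauli_Y))"

definition kronecker :: "complex mat \<Rightarrow> complex mat \<Rightarrow> complex mat" (infixr "\<otimes>\<^sub>K" 70) where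
  "A \<otimes>\<^sub>K B =
    mat (dim_row A * dim_row B) (dim_col A * dim_col B)
      (\<lambda>(i, j). A $$ (i div dim_row B, j div dim_col B) * B $$ (i mod dim_row B, j mod dim_col B))"

text \<open>Pairwise distinct points have pairwise distinct observables, so the image of a set of points
  lists every observable exactly once.\<close>

definition observable :: "nat \<Rightarrow> bit vec \<Rightarrow> complex mat" where
  "observable N g = foldr (\<otimes>\<^sub>K) (map (\<lambda>j. pauli (g $ j) (g $ (N + j))) [0..<N]) (1\<^sub>m 1)"


section \<open>Quantum configurations and contextuality\<close>

definition mat_product :: "nat \<Rightarrow> complex mat list \<Rightarrow> complex mat" where
  "mat_product N Ms = foldr (*) Ms (1\<^sub>m (2 ^ N))"

text \<open>The product over a finite set of matrices is required to have the given value for every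
  order of the factors. The observables of a context commute, so there it is the same to require
  this for one order. Finiteness excludes vacuous truth.\<close>

definition has_product :: "nat \<Rightarrow> complex mat set \<Rightarrow> complex mat \<Rightarrow> bool" where
  "has_product N c P \<longleftrightarrow>
    finite c \<and> (\<forall>Ms. distinct Ms \<and> set Ms = c \<longrightarrow> mat_product N Ms = P)"

definition positive :: "nat \<Rightarrow> complex mat set \<Rightarrow> bool" where
  "positive N c \<longleftrightarrow> has_product N c (1\<^sub>m (2 ^ N))"

definition negative :: "nat \<Rightarrow> complex mat set \<Rightarrow> bool" where
  "negative N c \<longleftrightarrow> has_product N c (- 1\<^sub>m (2 ^ N))"

text \<open>An observable on \<open>N\<close> qubits is a Hermitian operator on a space of dimension \<open>2 ^ N\<close>.\<close>

definition quantum_configuration ::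
    "nat \<Rightarrow> complex mat set \<Rightarrow> complex mat set set \<Rightarrow> bool" where
  "quantum_configuration N Ob C \<longleftrightarrow>
    finite Ob \<and> finite C \<and> (\<forall>c\<in>C. c \<subseteq> Ob) \<and>
    (\<forall>M\<in>Ob. M \<in> carrier_mat (2 ^ N) (2 ^ N) \<and> mat_adjoint M = M \<and> M * M = 1\<^sub>m (2 ^ N)) \<and>
    (\<forall>c\<in>C. \<forall>M\<in>c. \<forall>M'\<in>c. M * M' = M' * M) \<and>
    (\<forall>c\<in>C. positive N c \<or> negative N c)"

text \<open>Rows of the incidence matrix and entries of the valuation vector are indexed by the
  contexts, columns by the observables.\<close>

definition incidence :: "complex mat set \<Rightarrow> complex mat \<Rightarrow> bit" where
  "incidence c M = (if M \<in> c then 1 else 0)"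

definition valuation :: "nat \<Rightarrow> complex mat set \<Rightarrow> bit" where
  "valuation N c = (if negative N c then 1 else 0)"

definition contextual :: "nat \<Rightarrow> complex mat set \<Rightarrow> complex mat set set \<Rightarrow> bool" where
  "contextual N Ob C \<longleftrightarrow>
    \<not> (\<exists>x :: complex mat \<Rightarrow> bit.
          \<forall>c\<in>C. (\<Sum>M\<in>Ob. incidence c M * x M) = valuation N c)"

end

theory Submission
  imports Defs
begin

text \<open>
  Up to a power of \<open>\<i>\<close> the observable of \<open>g = (a, b)\<close> is \<open>X\<^sup>b Z\<^sup>a\<close>, and moving
  \<open>Z\<close>s past \<open>X\<close>s shows that the product of all observables of a list of vectors is
  \<open>\<i>\<^sup>W (-1)\<^sup>Q X\<^sup>s Z\<^sup>t\<close>. Here \<open>W\<close> is the total number of factors \<open>Y\<close>, \<open>Q\<close> is the number of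
  pairs \<open>g\<close> before \<open>h\<close> with \<open>\<beta>(g, h) = 1\<close>, where \<open>\<beta>\<close> pairs the \<open>Z\<close>-part of \<open>g\<close> with
  the \<open>X\<close>-part of \<open>h\<close>, and \<open>(t, s)\<close> is the sum of the vectors.

  Let the list enumerate a totally isotropic subspace \<open>U\<close>, so that \<open>16\<close> divides \<open>|U|\<close>. A linear
  functional takes the value \<open>1\<close> on none or half of \<open>U\<close>, and two functionals are simultaneously
  \<open>1\<close> on a multiple of \<open>|U| / 4\<close> vectors. Hence the vectors sum to \<open>0\<close> and \<open>4\<close> divides \<open>W\<close>.
  Isotropy means that \<open>\<beta>\<close> is symmetric on \<open>U\<close>, so \<open>g \<mapsto> \<beta>(g, g)\<close> is linear there, and
  \<open>2 Q + |{g. \<beta>(g, g) = 1}| = |{(g, h). \<beta>(g, h) = 1}|\<close> with both cardinalities divisible by \<open>8\<close>.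
  So \<open>Q\<close> is even and the product is the identity. As all contexts are positive, the zero
  assignment shows non-contextuality.
\<close>

text \<open>Bits stay in ring notation, so that distributivity and the lemmas on sums apply to
  them.\<close>

declare add_bit_eq_xor [simp del] mult_bit_eq_and [simp del]

section \<open>Counting in subspaces over the field with two elements\<close>

text \<open>Coefficient functions on a basis correspond bijectively to vectors: independence makes
  the kernel of \<open>lincomb\<close> trivial, and spanning makes it surjective.\<close>

lemma (in vectorspace) card_carrier_eq_power:
  assumes "finite A" and "basis A"
  shows "card (carrier V) = card (carrier K) ^ card A"
proof -
  have A: "A \<subseteq> carrier V" "lin_indpt A" "span A = carrier V"
    using assms(2) by (auto simp: basis_def)
  interpret L: linear_map K "func_space A" V "\<lambda>a. lincomb a A"
    by (rule lincomb_is_linear[OF assms(1) A(1)])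
  have car: "carrier (func_space A) = A \<rightarrow>\<^sub>E carrier K"
    by (simp add: func_space_def)
  have kernel: "a = \<zero>\<^bsub>func_space A\<^esub>"
    if a: "a \<in> A \<rightarrow>\<^sub>E carrier K" "lincomb a A = \<zero>\<^bsub>V\<^esub>" for a
  proof -
    have "a v = \<zero>\<^bsub>K\<^esub>" if "v \<in> A" for v
      using not_lindepD[OF A(2) assms(1) subset_refl, of a] a that by auto
    then show ?thesis
      using a(1) by (auto simp: func_space_def PiE_def extensional_def restrict_def)
  qed
  have zero_in: "\<zero>\<^bsub>func_space A\<^esub> \<in> A \<rightarrow>\<^sub>E carrier K"
    by (auto simp: func_space_def)
  have "L.ker = {\<zero>\<^bsub>func_space A\<^esub>}"
    unfolding L.ker_def car using kernel zero_in L.f0_is_0 by blast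
  then have inj: "inj_on (\<lambda>a. lincomb a A) (carrier (func_space A))"
    by (intro L.Ke0_imp_inj) simp
  have surj: "(\<lambda>a. lincomb a A) ` (A \<rightarrow>\<^sub>E carrier K) = carrier V"
  proof
    show "(\<lambda>a. lincomb a A) ` (A \<rightarrow>\<^sub>E carrier K) \<subseteq> carrier V"
      using A(1) by auto
    show "carrier V \<subseteq> (\<lambda>a. lincomb a A) ` (A \<rightarrow>\<^sub>E carrier K)"
    proof
      fix v assume "v \<in> carrier V"
      then obtain a where a: "a \<in> A \<rightarrow> carrier K" "lincomb a A = v"
        using finite_in_span[OF assms(1) A(1)] A(3) by metis
      \<comment> \<open>Restriction turns \<open>a\<close> into an extensional function without
        changing its values on \<open>A\<close>.\<close>
      have "lincomb (restrict a A) A = lincomb a A"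
        using a by (intro lincomb_restrict A(1)) auto
      then show "v \<in> (\<lambda>a. lincomb a A) ` (A \<rightarrow>\<^sub>E carrier K)"
        using a by (intro image_eqI[of _ _ "restrict a A"]) auto
    qed
  qed
  show ?thesis
    using card_image[OF inj, unfolded car surj] card_funcsetE[OF assms(1)] by (rule trans)
qed

text \<open>A finite space is a finite spanning set of itself, hence has a finite basis.\<close>

lemma (in vectorspace) card_carrier_eq_power_dim:
  assumes "finite (carrier V)"
  shows "card (carrier V) = card (carrier K) ^ dim"
proof -
  have "span (carrier V) = carrier V"
    using in_own_span[of "carrier V"] span_is_subset2[of "carrier V"] by auto
  then have "fin_dim"
    unfolding fin_dim_def using assms by auto
  then obtain A where "finite A" "basis A"
    using finite_basis_exists by auto
  then show ?thesis
    using card_carrier_eq_power dim_basis by simp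
qed

text \<open>Closure under scalars is implicit: the only multiples of \<open>x\<close> are the zero
  vector and \<open>x\<close>.\<close>

locale bit_subspace =
  fixes n :: nat and U :: "bit vec set"
  assumes carrier: "U \<subseteq> carrier_vec n"
    and zero: "0\<^sub>v n \<in> U"
    and add: "x \<in> U \<Longrightarrow> y \<in> U \<Longrightarrow> x + y \<in> U"

lemma finite_UNIV_bit: "finite (UNIV :: bit set)"
proof -
  have "(UNIV :: bit set) = {0, 1}" by (auto intro: bit.exhaust)
  then show ?thesis by (metis finite.emptyI finite.insertI)
qed

lemma card_UNIV_bit: "card (UNIV :: bit set) = 2"
proof -
  have "(UNIV :: bit set) = {0, 1}" by (auto intro: bit.exhaust)
  then show ?thesis by (metis card_2_iff zero_neq_one)
qed

lemma finite_carrier_vec_bit: "finite (carrier_vec n :: bit vec set)"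
proof -
  have "carrier_vec n \<subseteq> vec_of_list ` {xs :: bit list. set xs \<subseteq> UNIV \<and> length xs = n}"
  proof
    fix v :: "bit vec" assume "v \<in> carrier_vec n"
    then show "v \<in> vec_of_list ` {xs :: bit list. set xs \<subseteq> UNIV \<and> length xs = n}"
      by (intro image_eqI[of _ _ "list_of_vec v"]) (simp_all add: vec_list)
  qed
  then show ?thesis
    using finite_lists_length_eq[OF finite_UNIV_bit] by (metis finite_imageI finite_subset)
qed

lemma bit_vec_add_self: "x \<in> carrier_vec n \<Longrightarrow> x + x = 0\<^sub>v n" for x :: "bit vec"
  by (intro eq_vecI) (auto simp flip: mult_2)

text \<open>The bridge from library subspaces and their dimension to the closure properties and the
  cardinality on which all later counting rests.\<close>

lemma subspace_bit_subspace:
  assumes "VectorSpace.subspace class_ring U (module_vec TYPE(bit) n)"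
  shows "bit_subspace n U"
    and "card U = 2 ^ vectorspace.dim class_ring ((module_vec TYPE(bit) n)\<lparr>carrier := U\<rparr>)"
proof -
  have sub: "submodule class_ring U (module_vec TYPE(bit) n)"
    using assms by (simp add: VectorSpace.subspace_def)
  show *: "bit_subspace n U"
  proof
    show "U \<subseteq> carrier_vec n" "0\<^sub>v n \<in> U"
      using sub by (auto simp: submodule_def module_vec_simps)
    show "x + y \<in> U" if "x \<in> U" "y \<in> U" for x y
      using sub that by (auto simp: submodule_def module_vec_simps)
  qed
  interpret vectorspace class_ring "(module_vec TYPE(bit) n)\<lparr>carrier := U\<rparr>"
    by (rule vectorspace.subspace_is_vs[OF vec_vs assms])
  have "finite U"
    using bit_subspace.carrier[OF *] finite_carrier_vec_bit finite_subset by blast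
  then show "card U = 2 ^ vectorspace.dim class_ring ((module_vec TYPE(bit) n)\<lparr>carrier := U\<rparr>)"
    using card_carrier_eq_power_dim by (simp add: card_UNIV_bit)
qed

context bit_subspace
begin

lemma finite: "finite U"
  using carrier finite_carrier_vec_bit finite_subset by blast

text \<open>If \<open>f u = 1\<close>, translation by \<open>u\<close> exchanges the two fibres of
  \<open>f\<close>, so \<open>f\<close> is \<open>1\<close> on exactly half of \<open>U\<close>. The
  factor \<open>2\<close> avoids a division.\<close>

lemma card_dvd_count_linear:
  fixes f :: "bit vec \<Rightarrow> bit"
  assumes f: "\<And>x y. x \<in> U \<Longrightarrow> y \<in> U \<Longrightarrow> f (x + y) = f x + f y"
  shows "card U dvd 2 * (\<Sum>x\<in>U. of_bool (f x = 1))"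
proof (cases "\<exists>u\<in>U. f u = 1")
  case True
  then obtain u where u: "u \<in> U" "f u = 1" by auto
  \<comment> \<open>Since \<open>u + u\<close> is zero, translation by \<open>u\<close> is its own
    inverse.\<close>
  have uu: "u + (u + x) = x" if "x \<in> U" for x
    using that u(1) carrier bit_vec_add_self[of u n]
    by (metis (no_types, lifting) assoc_add_vec left_zero_vec subset_iff)
  have fu: "f (u + x) = 1 + f x" if "x \<in> U" for x
    using f u that by simp
  have "(\<Sum>x\<in>U. of_bool (f x = 1)) = (\<Sum>x\<in>U. of_bool (f x = 0) :: nat)"
    by (rule sum.reindex_bij_witness[of _ "\<lambda>x. u + x" "\<lambda>x. u + x"])
      (use uu fu add u in \<open>auto simp flip: mult_2\<close>)
  then have "2 * (\<Sum>x\<in>U. of_bool (f x = 1)) = (\<Sum>x\<in>U. of_bool (f x = 1) + of_bool (f x = 0) :: nat)"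
    by (simp add: sum.distrib)
  also have "\<dots> = (\<Sum>x\<in>U. 1)"
    by (intro sum.cong) auto
  finally show ?thesis by simp
next
  case False
  then have "(\<Sum>x\<in>U. of_bool (f x = 1)) = (0 :: nat)"
    by (intro sum.neutral) auto
  then show ?thesis by simp
qed

text \<open>Counting where \<open>f\<close>, \<open>g\<close> and \<open>f + g\<close> are
  \<open>1\<close> determines twice the number of common ones, and the previous lemma applies to
  each of these three additive maps.\<close>

lemma card_dvd_count_linear2:
  fixes f g :: "bit vec \<Rightarrow> bit"
  assumes f: "\<And>x y. x \<in> U \<Longrightarrow> y \<in> U \<Longrightarrow> f (x + y) = f x + f y"
    and g: "\<And>x y. x \<in> U \<Longrightarrow> y \<in> U \<Longrightarrow> g (x + y) = g x + g y"
  shows "card U dvd 4 * (\<Sum>x\<in>U. of_bool (f x = 1 \<and> g x = 1))"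
proof -
  define c where "c h = (\<Sum>x\<in>U. of_bool (h x = (1::bit)) :: nat)" for h
  let ?p = "\<Sum>x\<in>U. of_bool (f x = 1 \<and> g x = 1) :: nat"
  have "of_bool (f x = 1) + of_bool (g x = 1) =
      of_bool (f x + g x = 1) + 2 * (of_bool (f x = 1 \<and> g x = 1) :: nat)" for x
    by (cases "f x"; cases "g x") simp_all
  then have "c f + c g = c (\<lambda>x. f x + g x) + 2 * ?p"
    unfolding c_def sum_distrib_left sum.distrib[symmetric] by (intro sum.cong refl)
  then have "2 * c f + 2 * c g = 2 * c (\<lambda>x. f x + g x) + 4 * ?p"
    by simp
  moreover have "card U dvd 2 * c f" "card U dvd 2 * c g" "card U dvd 2 * c (\<lambda>x. f x + g x)"
    unfolding c_def by (intro card_dvd_count_linear; simp add: f g)+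
  ultimately show ?thesis
    using dvd_add_right_iff[of "card U" "2 * c (\<lambda>x. f x + g x)" "4 * ?p"]
      dvd_add[of "card U" "2 * c f" "2 * c g"] by simp
qed

end

section \<open>Kronecker products\<close>

lemma dim_kronecker [simp]:
  "dim_row (A \<otimes>\<^sub>K B) = dim_row A * dim_row B"
  "dim_col (A \<otimes>\<^sub>K B) = dim_col A * dim_col B"
  by (simp_all add: kronecker_def)

lemma kronecker_carrier:
  "A \<in> carrier_mat a b \<Longrightarrow> B \<in> carrier_mat c d \<Longrightarrow> A \<otimes>\<^sub>K B \<in> carrier_mat (a * c) (b * d)"
  by auto

lemma index_kronecker:
  "i < dim_row A * dim_row B \<Longrightarrow> j < dim_col A * dim_col B \<Longrightarrow>
    (A \<otimes>\<^sub>K B) $$ (i, j) =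
      A $$ (i div dim_row B, j div dim_col B) * B $$ (i mod dim_row B, j mod dim_col B)"
  by (simp add: kronecker_def)

lemma div_less_of_less_mult: "i < a * b \<Longrightarrow> i div b < a" for a b i :: nat
  by (simp add: less_mult_imp_div_less)

lemma mod_less_of_less_mult: "i < a * b \<Longrightarrow> i mod b < b" for a b i :: nat
  by (cases "b = 0") simp_all

text \<open>Quotient and remainder identify an index below \<open>a * b\<close> with a pair, which
  splits the summation index of a product of Kronecker products.\<close>

lemma sum_lessThan_mult:
  fixes f :: "nat \<Rightarrow> nat \<Rightarrow> 'a :: comm_monoid_add"
  shows "(\<Sum>k<a * b. f (k div b) (k mod b)) = (\<Sum>p<a. \<Sum>q<b. f p q)"
proof -
  have "(\<Sum>p<a. \<Sum>q<b. f p q) = (\<Sum>(p, q)\<in>{..<a} \<times> {..<b}. f p q)"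
    by (simp add: sum.cartesian_product)
  also have "\<dots> = (\<Sum>k<a * b. f (k div b) (k mod b))"
  proof (rule sum.reindex_bij_witness[of _ "\<lambda>k. (k div b, k mod b)" "\<lambda>(p, q). p * b + q"])
    fix pq assume "pq \<in> {..<a} \<times> {..<b}"
    then obtain p q where pq: "pq = (p, q)" "p < a" "q < b" by auto
    have "p * b + q < Suc p * b" using pq by simp
    also have "\<dots> \<le> a * b" using pq by (intro mult_le_mono1) simp
    finally show "(case pq of (p, q) \<Rightarrow> p * b + q) \<in> {..<a * b}" using pq by simp
  qed (auto simp: div_less_of_less_mult mod_less_of_less_mult)
  finally show ?thesis by simp
qed

text \<open>The mixed-product rule: after splitting the summation index, the double sum factors into
  one entry of \<open>A * C\<close> and one of \<open>B * D\<close>.\<close>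

lemma kronecker_mult:
  assumes "dim_col A = dim_row C" and "dim_col B = dim_row D"
  shows "(A \<otimes>\<^sub>K B) * (C \<otimes>\<^sub>K D) = (A * C) \<otimes>\<^sub>K (B * D)"
proof (rule eq_matI)
  fix i j
  assume "i < dim_row ((A * C) \<otimes>\<^sub>K (B * D))" "j < dim_col ((A * C) \<otimes>\<^sub>K (B * D))"
  then have i: "i < dim_row A * dim_row B" and j: "j < dim_col C * dim_col D" by simp_all
  let ?b = "dim_row D" and ?a = "dim_row C"
  note b = div_less_of_less_mult[OF i] mod_less_of_less_mult[OF i]
    div_less_of_less_mult[OF j] mod_less_of_less_mult[OF j]
  have "((A \<otimes>\<^sub>K B) * (C \<otimes>\<^sub>K D)) $$ (i, j) =
      (\<Sum>k<?a * ?b. (A \<otimes>\<^sub>K B) $$ (i, k) * (C \<otimes>\<^sub>K D) $$ (k, j))"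
    using i j assms by (simp add: scalar_prod_def atLeast0LessThan)
  also have "\<dots> = (\<Sum>k<?a * ?b.
      (A $$ (i div dim_row B, k div ?b) * C $$ (k div ?b, j div dim_col D)) *
      (B $$ (i mod dim_row B, k mod ?b) * D $$ (k mod ?b, j mod dim_col D)))"
    using i j assms by (intro sum.cong refl) (simp add: index_kronecker)
  also have "\<dots> = (\<Sum>p<?a. \<Sum>q<?b.
      (A $$ (i div dim_row B, p) * C $$ (p, j div dim_col D)) *
      (B $$ (i mod dim_row B, q) * D $$ (q, j mod dim_col D)))"
    by (rule sum_lessThan_mult)
  also have "\<dots> = (A * C) $$ (i div dim_row B, j div dim_col D) *
      (B * D) $$ (i mod dim_row B, j mod dim_col D)"
    using b assms by (simp add: scalar_prod_def atLeast0LessThan sum_product)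
  also have "\<dots> = ((A * C) \<otimes>\<^sub>K (B * D)) $$ (i, j)"
    using i j by (simp add: index_kronecker)
  finally show "((A \<otimes>\<^sub>K B) * (C \<otimes>\<^sub>K D)) $$ (i, j) = ((A * C) \<otimes>\<^sub>K (B * D)) $$ (i, j)" .
qed simp_all

lemma kronecker_smult: "(a \<cdot>\<^sub>m A) \<otimes>\<^sub>K (b \<cdot>\<^sub>m B) = (a * b) \<cdot>\<^sub>m (A \<otimes>\<^sub>K B)"
  by (rule eq_matI) (simp_all add: index_kronecker div_less_of_less_mult mod_less_of_less_mult)

lemma kronecker_one: "1\<^sub>m a \<otimes>\<^sub>K 1\<^sub>m b = 1\<^sub>m (a * b)"
proof (rule eq_matI)
  fix i j assume ij: "i < dim_row (1\<^sub>m (a * b) :: complex mat)" "j < dim_col (1\<^sub>m (a * b) :: complex mat)"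
  have "i = j \<longleftrightarrow> i div b = j div b \<and> i mod b = j mod b"
    by (metis div_mult_mod_eq)
  with ij show "(1\<^sub>m a \<otimes>\<^sub>K 1\<^sub>m b) $$ (i, j) = 1\<^sub>m (a * b) $$ (i, j)"
    by (auto simp: index_kronecker div_less_of_less_mult mod_less_of_less_mult)
qed simp_all

section \<open>Adjoints of Kronecker products\<close>

lemma dim_mat_adjoint [simp]:
  "dim_row (mat_adjoint A) = dim_col A" "dim_col (mat_adjoint A) = dim_row A"
  by (simp_all add: mat_adjoint_def)

lemma index_mat_adjoint:
  "i < dim_col A \<Longrightarrow> j < dim_row A \<Longrightarrow> mat_adjoint A $$ (i, j) = conjugate (A $$ (j, i))"
  by (simp add: mat_adjoint_def mat_of_rows_index)

lemma mat_adjoint_kronecker: "mat_adjoint (A \<otimes>\<^sub>K B) = mat_adjoint A \<otimes>\<^sub>K mat_adjoint B"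
  by (rule eq_matI)
    (simp_all add: index_kronecker index_mat_adjoint div_less_of_less_mult mod_less_of_less_mult)

lemma mat_adjoint_one: "mat_adjoint (1\<^sub>m n :: complex mat) = 1\<^sub>m n"
  by (rule eq_matI) (auto simp: index_mat_adjoint)

text \<open>This abstracts the shape of \<open>observable\<close>, so that identities for one qubit
  lift by induction on the list of qubits.\<close>

definition kronecker_list :: "('a \<Rightarrow> complex mat) \<Rightarrow> 'a list \<Rightarrow> complex mat" where
  "kronecker_list A js = foldr (\<otimes>\<^sub>K) (map A js) (1\<^sub>m 1)"

lemma kronecker_list_simps [simp]:
  "kronecker_list A [] = 1\<^sub>m 1"
  "kronecker_list A (j # js) = A j \<otimes>\<^sub>K kronecker_list A js"
  by (simp_all add: kronecker_list_def)

lemma kronecker_list_cong: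
  "(\<And>j. j \<in> set js \<Longrightarrow> A j = B j) \<Longrightarrow> kronecker_list A js = kronecker_list B js"
  by (induction js) simp_all

lemma kronecker_list_carrier:
  "(\<And>j. A j \<in> carrier_mat d d) \<Longrightarrow>
    kronecker_list A js \<in> carrier_mat (d ^ length js) (d ^ length js)"
  by (induction js) (simp_all add: kronecker_carrier)

lemma kronecker_list_mult:
  assumes "\<And>j. A j \<in> carrier_mat d d" and "\<And>j. B j \<in> carrier_mat d d"
  shows "kronecker_list A js * kronecker_list B js = kronecker_list (\<lambda>j. A j * B j) js"
proof (induction js)
  case (Cons j js)
  have "dim_col (A j) = dim_row (B j)"
    "dim_col (kronecker_list A js) = dim_row (kronecker_list B js)"
    using assms kronecker_list_carrier[of A d js] kronecker_list_carrier[of B d js]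
    by (metis carrier_matD)+
  then show ?case
    by (simp add: kronecker_mult Cons.IH)
qed simp

lemma kronecker_list_smult:
  "kronecker_list (\<lambda>j. c j \<cdot>\<^sub>m A j) js = (\<Prod>j\<leftarrow>js. c j) \<cdot>\<^sub>m kronecker_list A js"
proof (induction js)
  case Nil
  show ?case by (rule eq_matI) simp_all
qed (simp add: kronecker_smult)

lemma kronecker_list_one: "kronecker_list (\<lambda>j. 1\<^sub>m d) js = 1\<^sub>m (d ^ length js)"
  by (induction js) (simp_all add: kronecker_one)

lemma mat_adjoint_kronecker_list:
  "mat_adjoint (kronecker_list A js) = kronecker_list (\<lambda>j. mat_adjoint (A j)) js"
  by (induction js) (simp_all add: mat_adjoint_kronecker mat_adjoint_one)

section \<open>Products of observables\<close>

text \<open>The nontrivial additive character of the field with two elements.\<close>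

definition bit_sign :: "bit \<Rightarrow> complex" where
  "bit_sign b = (-1) ^ of_bool (b = 1)"

lemma bit_sign_simps [simp]: "bit_sign 0 = 1" "bit_sign 1 = -1"
  by (simp_all add: bit_sign_def)

lemma bit_sign_add: "bit_sign (a + b) = bit_sign a * bit_sign b"
  by (cases a; cases b) simp_all

lemma bit_sign_sum: "bit_sign (sum f A) = (\<Prod>x\<in>A. bit_sign (f x))"
  by (induction A rule: infinite_finite_induct) (simp_all add: bit_sign_add)

lemma bit_sign_inject: "bit_sign a = bit_sign b \<longleftrightarrow> a = b"
  by (cases a; cases b) simp_all

text \<open>The real matrix \<open>X\<^sup>b Z\<^sup>a\<close>; \<open>Y = \<i> X Z\<close> explains the scalar.\<close>

definition weyl1 :: "bit \<Rightarrow> bit \<Rightarrow> complex mat" where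
  "weyl1 a b = (if a = 1 \<and> b = 1 then - \<i> else 1) \<cdot>\<^sub>m pauli a b"

lemma pauli_carrier: "pauli a b \<in> carrier_mat 2 2"
  by (auto simp: pauli_def pauli_X_def pauli_Y_def pauli_Z_def mat_of_rows_list_def)

lemma weyl1_carrier: "weyl1 a b \<in> carrier_mat 2 2"
  by (simp add: weyl1_def pauli_carrier)

lemma pauli_eq_weyl1: "pauli a b = \<i> ^ of_bool (a = 1 \<and> b = 1) \<cdot>\<^sub>m weyl1 a b"
  by (rule eq_matI) (auto simp: weyl1_def)

lemma mat_adjoint_pauli: "mat_adjoint (pauli a b) = pauli a b"
proof (rule eq_matI)
  fix i j assume "i < dim_row (pauli a b)" "j < dim_col (pauli a b)"
  then have ij: "i < 2" "j < 2" and dim: "dim_row (pauli a b) = 2" "dim_col (pauli a b) = 2"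
    using pauli_carrier[of a b] by auto
  have "conjugate (pauli a b $$ (j, i)) = pauli a b $$ (i, j)"
    using less_2_cases[OF ij(1)] less_2_cases[OF ij(2)]
    by (cases a; cases b)
      (auto simp: pauli_def pauli_X_def pauli_Y_def pauli_Z_def mat_of_rows_list_def)
  then show "mat_adjoint (pauli a b) $$ (i, j) = pauli a b $$ (i, j)"
    using ij dim by (simp add: index_mat_adjoint)
qed (use pauli_carrier[of a b] in auto)

text \<open>\<open>X\<close> exchanges diagonal and off-diagonal positions, and \<open>Z\<close> on
  the right puts its sign on column \<open>1\<close>.\<close>

lemma weyl1_eq:
  "weyl1 a b = mat 2 2 (\<lambda>(i, j). if (i = j) = (b = 0) then (if j = 1 then bit_sign a else 1) else 0)"
  by (rule eq_matI; cases a; cases b)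
    (auto simp: weyl1_def pauli_def pauli_X_def pauli_Y_def pauli_Z_def
      mat_of_rows_list_def less_2_cases_iff)

text \<open>Moving \<open>Z\<close> past \<open>X\<close> costs a sign, here when
  \<open>a = d = 1\<close>. Without the scalar of \<open>Y\<close>, no other phases arise.\<close>

lemma weyl1_mult: "weyl1 a b * weyl1 c d = bit_sign (a * d) \<cdot>\<^sub>m weyl1 (a + c) (b + d)"
  by (rule eq_matI; cases a; cases b; cases c; cases d)
    (auto simp: weyl1_eq scalar_prod_def less_2_cases_iff numeral_2_eq_2)

lemma weyl1_zero: "weyl1 0 0 = 1\<^sub>m 2"
  by (rule eq_matI) (auto simp: weyl1_eq)

section \<open>Weyl operators on several qubits\<close>

definition weyl :: "nat \<Rightarrow> bit vec \<Rightarrow> complex mat" where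
  "weyl N g = kronecker_list (\<lambda>j. weyl1 (g $ j) (g $ (N + j))) [0..<N]"

text \<open>A natural number rather than a bit, because as an exponent of \<open>\<i>\<close> it
  matters modulo \<open>4\<close>.\<close>

definition y_count :: "nat \<Rightarrow> bit vec \<Rightarrow> nat" where
  "y_count N g = (\<Sum>j<N. of_bool (g $ j = 1 \<and> g $ (N + j) = 1))"

text \<open>The form \<beta> of the overview. It records the sign of a product in a given order and
  is not symmetric in general.\<close>

definition zx_form :: "nat \<Rightarrow> bit vec \<Rightarrow> bit vec \<Rightarrow> bit" where
  "zx_form N g h = (\<Sum>j<N. g $ j * h $ (N + j))"

text \<open>In characteristic two, isotropy thus says exactly that \<open>zx_form\<close> is
  symmetric on the subspace.\<close>

lemma symp_form_eq_zx_form: "symp_form N g h = zx_form N g h + zx_form N h g"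
  by (simp add: symp_form_def zx_form_def sum.distrib mult.commute)

lemma zx_form_zero_right: "zx_form N g (0\<^sub>v (2 * N)) = 0"
  by (simp add: zx_form_def)

lemma zx_form_add_left:
  "g \<in> carrier_vec (2 * N) \<Longrightarrow> g' \<in> carrier_vec (2 * N) \<Longrightarrow>
    zx_form N (g + g') h = zx_form N g h + zx_form N g' h"
  by (simp add: zx_form_def sum.distrib distrib_right)

lemma zx_form_add_right:
  "h \<in> carrier_vec (2 * N) \<Longrightarrow> h' \<in> carrier_vec (2 * N) \<Longrightarrow>
    zx_form N g (h + h') = zx_form N g h + zx_form N g h'"
  by (simp add: zx_form_def sum.distrib distrib_left)

lemma prod_list_upt: "(\<Prod>j\<leftarrow>[0..<N]. f j) = (\<Prod>j<N. f j)"
  using prod.distinct_set_conv_list[of "[0..<N]" f] by (simp add: atLeast0LessThan)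

lemma weyl_carrier: "weyl N g \<in> carrier_mat (2 ^ N) (2 ^ N)"
  using kronecker_list_carrier[OF weyl1_carrier, of _ _ "[0..<N]"] by (simp add: weyl_def)

lemma weyl_zero: "weyl N (0\<^sub>v (2 * N)) = 1\<^sub>m (2 ^ N)"
proof -
  have "weyl N (0\<^sub>v (2 * N)) = kronecker_list (\<lambda>j. 1\<^sub>m 2) [0..<N]"
    unfolding weyl_def by (intro kronecker_list_cong) (simp add: weyl1_zero)
  then show ?thesis by (simp add: kronecker_list_one)
qed

text \<open>The signs of the individual qubits multiply to the character of the sum defining
  \<open>zx_form\<close>.\<close>

lemma weyl_mult:
  assumes "g \<in> carrier_vec (2 * N)" and "h \<in> carrier_vec (2 * N)"
  shows "weyl N g * weyl N h = bit_sign (zx_form N g h) \<cdot>\<^sub>m weyl N (g + h)"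
proof -
  have "weyl N g * weyl N h = kronecker_list (\<lambda>j. bit_sign (g $ j * h $ (N + j)) \<cdot>\<^sub>m
      weyl1 (g $ j + h $ j) (g $ (N + j) + h $ (N + j))) [0..<N]"
    unfolding weyl_def by (subst kronecker_list_mult[of _ 2]) (simp_all add: weyl1_carrier weyl1_mult)
  also have "\<dots> = bit_sign (zx_form N g h) \<cdot>\<^sub>m
      kronecker_list (\<lambda>j. weyl1 (g $ j + h $ j) (g $ (N + j) + h $ (N + j))) [0..<N]"
    unfolding kronecker_list_smult prod_list_upt zx_form_def bit_sign_sum ..
  also have "kronecker_list (\<lambda>j. weyl1 (g $ j + h $ j) (g $ (N + j) + h $ (N + j))) [0..<N] =
      weyl N (g + h)"
    unfolding weyl_def using assms by (intro kronecker_list_cong) simp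
  finally show ?thesis .
qed

lemma observable_eq_weyl: "observable N g = \<i> ^ y_count N g \<cdot>\<^sub>m weyl N g"
proof -
  have "observable N g = kronecker_list (\<lambda>j. pauli (g $ j) (g $ (N + j))) [0..<N]"
    by (simp add: observable_def kronecker_list_def)
  then show ?thesis
    unfolding pauli_eq_weyl1 kronecker_list_smult prod_list_upt weyl_def y_count_def power_sum .
qed

lemma observable_carrier: "observable N g \<in> carrier_mat (2 ^ N) (2 ^ N)"
  by (simp add: observable_eq_weyl weyl_carrier)

lemma observable_zero: "observable N (0\<^sub>v (2 * N)) = 1\<^sub>m (2 ^ N)"
  by (rule eq_matI) (simp_all add: observable_eq_weyl weyl_zero y_count_def)

lemma mat_adjoint_observable: "mat_adjoint (observable N g) = observable N g"
  using mat_adjoint_kronecker_list[of "\<lambda>j. pauli (g $ j) (g $ (N + j))" "[0..<N]"]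
  by (simp add: observable_def kronecker_list_def mat_adjoint_pauli)

section \<open>Commutation and squares of observables\<close>

lemma smult_mult_smult_mat:
  fixes A B :: "'a :: comm_ring_1 mat"
  assumes "A \<in> carrier_mat n n" and "B \<in> carrier_mat n n"
  shows "(a \<cdot>\<^sub>m A) * (b \<cdot>\<^sub>m B) = (a * b) \<cdot>\<^sub>m (A * B)"
  using assms by (intro eq_matI) (auto simp: mult_ac)

lemma smult_smult_mat: "a \<cdot>\<^sub>m (b \<cdot>\<^sub>m A) = (a * b) \<cdot>\<^sub>m A" for A :: "'a :: semigroup_mult mat"
  by (intro eq_matI) (auto simp: mult.assoc)

lemma one_smult_mat: "1 \<cdot>\<^sub>m A = A" for A :: "'a :: monoid_mult mat"
  by (intro eq_matI) auto

lemma observable_mult: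
  assumes "g \<in> carrier_vec (2 * N)" and "h \<in> carrier_vec (2 * N)"
  shows "observable N g * observable N h =
    (\<i> ^ (y_count N g + y_count N h) * bit_sign (zx_form N g h)) \<cdot>\<^sub>m weyl N (g + h)"
  unfolding observable_eq_weyl smult_mult_smult_mat[OF weyl_carrier weyl_carrier]
    weyl_mult[OF assms] smult_smult_mat power_add ..

text \<open>The two orders share the phase and the Weyl operator; they differ only by the signs of
  \<open>zx_form N g h\<close> and \<open>zx_form N h g\<close>.\<close>

lemma observable_commutation:
  assumes "g \<in> carrier_vec (2 * N)" and "h \<in> carrier_vec (2 * N)"
  shows "observable N g * observable N h =
    bit_sign (symp_form N g h) \<cdot>\<^sub>m (observable N h * observable N g)"
proof -
  have "bit_sign (zx_form N g h) = bit_sign (symp_form N g h) * bit_sign (zx_form N h g)"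
    unfolding symp_form_eq_zx_form
    by (cases "zx_form N g h"; cases "zx_form N h g") simp_all
  moreover have "h + g = g + h"
    using assms(2,1) by (rule comm_add_vec)
  ultimately show ?thesis
    unfolding observable_mult[OF assms] observable_mult[OF assms(2,1)] smult_smult_mat
    by (simp add: mult_ac add.commute[of "y_count N h"])
qed

text \<open>Each factor \<open>Y\<close> contributes -1 from the square of \<open>\<i>\<close> and
  another -1 from \<open>zx_form N g g\<close>.\<close>

lemma observable_square:
  assumes "g \<in> carrier_vec (2 * N)"
  shows "observable N g * observable N g = 1\<^sub>m (2 ^ N)"
proof -
  have "bit_sign (zx_form N g g) = (-1) ^ y_count N g"
    unfolding zx_form_def y_count_def bit_sign_sum power_sum
  proof (intro prod.cong refl)
    fix j
    show "bit_sign (g $ j * g $ (N + j)) = (- 1) ^ of_bool (g $ j = 1 \<and> g $ (N + j) = 1)"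
      by (cases "g $ j"; cases "g $ (N + j)") simp_all
  qed
  then have "\<i> ^ (y_count N g + y_count N g) * bit_sign (zx_form N g g) = 1"
    by (simp flip: mult_2 add: power_mult power_mult_distrib[symmetric])
  then show ?thesis
    unfolding observable_mult[OF assms assms]
    by (simp add: bit_vec_add_self[OF assms] weyl_zero one_smult_mat)
qed

section \<open>Vectors are determined by their observables\<close>

lemma symp_form_unit_vec:
  assumes "j < N"
  shows "symp_form N g (unit_vec (2 * N) j) = g $ (N + j)"
    and "symp_form N g (unit_vec (2 * N) (N + j)) = g $ j"
proof -
  have "symp_form N g (unit_vec (2 * N) j) = (\<Sum>i<N. if i = j then g $ (N + i) else 0)"
    unfolding symp_form_def using assms by (intro sum.cong) auto
  then show "symp_form N g (unit_vec (2 * N) j) = g $ (N + j)"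
    using assms by simp
  have "symp_form N g (unit_vec (2 * N) (N + j)) = (\<Sum>i<N. if i = j then g $ i else 0)"
    unfolding symp_form_def using assms by (intro sum.cong) auto
  then show "symp_form N g (unit_vec (2 * N) (N + j)) = g $ j"
    using assms by simp
qed

lemma smult_mat_cancel_right:
  fixes M :: "'a :: idom mat"
  assumes "a \<cdot>\<^sub>m M = b \<cdot>\<^sub>m M" and "M \<noteq> 0\<^sub>m (dim_row M) (dim_col M)"
  shows "a = b"
proof -
  obtain i j where ij: "i < dim_row M" "j < dim_col M" "M $$ (i, j) \<noteq> 0"
    using assms(2) by (metis eq_matI index_zero_mat)
  then have "a * M $$ (i, j) = b * M $$ (i, j)"
    using assms(1) by (metis index_smult_mat(1))
  then show ?thesis using ij(3) by simp
qed

text \<open>Observables are invertible, being their own inverses, so a zero product would force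
  \<open>observable N h\<close> and hence its square to vanish.\<close>

lemma observable_mult_nonzero:
  assumes "g \<in> carrier_vec (2 * N)" and "h \<in> carrier_vec (2 * N)"
  shows "observable N g * observable N h \<noteq> 0\<^sub>m (2 ^ N) (2 ^ N)"
proof
  assume *: "observable N g * observable N h = 0\<^sub>m (2 ^ N) (2 ^ N)"
  have "observable N h = (observable N g * observable N g) * observable N h"
    using observable_square[OF assms(1)] by (simp add: left_mult_one_mat[OF observable_carrier])
  also have "\<dots> = observable N g * (observable N g * observable N h)"
    by (rule assoc_mult_mat[OF observable_carrier observable_carrier observable_carrier])
  also have "\<dots> = 0\<^sub>m (2 ^ N) (2 ^ N)"
    unfolding * by (rule right_mult_zero_mat[OF observable_carrier])
  finally have "1\<^sub>m (2 ^ N) = (0\<^sub>m (2 ^ N) (2 ^ N) :: complex mat)"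
    using observable_square[OF assms(2)] by simp
  \<comment> \<open>The entry at \<open>(0, 0)\<close> exists because \<open>2 ^ N\<close> is
    positive.\<close>
  then have "1\<^sub>m (2 ^ N) $$ (0, 0) = (0\<^sub>m (2 ^ N) (2 ^ N) :: complex mat) $$ (0, 0)"
    by (rule arg_cong)
  then show False by simp
qed

text \<open>The coordinates of \<open>g\<close> are read off from which observables of unit vectors commute with the
  observable of \<open>g\<close>.\<close>

lemma inj_on_observable: "inj_on (observable N) (carrier_vec (2 * N))"
proof (rule inj_onI)
  fix g h :: "bit vec"
  assume g: "g \<in> carrier_vec (2 * N)" and h: "h \<in> carrier_vec (2 * N)"
    and eq: "observable N g = observable N h"
  have symp: "symp_form N g w = symp_form N h w" if w: "w \<in> carrier_vec (2 * N)" for w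
  proof -
    have "bit_sign (symp_form N g w) \<cdot>\<^sub>m (observable N w * observable N g) =
        bit_sign (symp_form N h w) \<cdot>\<^sub>m (observable N w * observable N g)"
      using observable_commutation[OF g w] observable_commutation[OF h w] eq by metis
    then have "bit_sign (symp_form N g w) = bit_sign (symp_form N h w)"
      using observable_mult_nonzero[OF w g] observable_carrier[of N w] observable_carrier[of N g]
      by (intro smult_mat_cancel_right) auto
    then show ?thesis by (simp add: bit_sign_inject)
  qed
  show "g = h"
  proof (rule eq_vecI)
    fix i assume "i < dim_vec h"
    then have "i < 2 * N" using h by simp
    then consider "i < N" | j where "i = N + j" "j < N"
      by (metis add_less_cancel_left le_Suc_ex mult_2 not_le)
    then show "g $ i = h $ i"
    proof cases
      case 1
      then show ?thesis
        using symp[of "unit_vec (2 * N) (N + i)"] by (simp add: symp_form_unit_vec)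
    next
      case 2
      then show ?thesis
        using symp[of "unit_vec (2 * N) j"] by (simp add: symp_form_unit_vec)
    qed
  qed (use g h in simp)
qed

section \<open>Normal form of ordered products\<close>

fun pair_count :: "('a \<Rightarrow> 'a \<Rightarrow> bit) \<Rightarrow> 'a list \<Rightarrow> nat" where
  "pair_count B [] = 0"
| "pair_count B (x # xs) = (\<Sum>y\<leftarrow>xs. of_bool (B x y = 1)) + pair_count B xs"

text \<open>A symmetric array consists of its diagonal and two equal triangles;
  \<open>pair_count\<close> counts one triangle.\<close>

lemma pair_count_double:
  assumes "\<And>x y. x \<in> set xs \<Longrightarrow> y \<in> set xs \<Longrightarrow> B x y = B y x"
  shows "2 * pair_count B xs + (\<Sum>x\<leftarrow>xs. of_bool (B x x = 1)) =
    (\<Sum>x\<leftarrow>xs. \<Sum>y\<leftarrow>xs. of_bool (B x y = 1))"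
  using assms
proof (induction xs)
  case (Cons x xs)
  have "(\<Sum>y\<leftarrow>xs. of_bool (B y x = 1)) = (\<Sum>y\<leftarrow>xs. of_bool (B x y = 1) :: nat)"
    using Cons.prems by (intro arg_cong[of _ _ sum_list] map_cong refl) simp
  moreover have "2 * pair_count B xs + (\<Sum>x\<leftarrow>xs. of_bool (B x x = 1)) =
      (\<Sum>x\<leftarrow>xs. \<Sum>y\<leftarrow>xs. of_bool (B x y = 1))"
    using Cons.prems by (intro Cons.IH) simp
  ultimately show ?case
    by (simp add: sum_list_addf)
qed simp

abbreviation vec_sum_list :: "nat \<Rightarrow> bit vec list \<Rightarrow> bit vec" where
  "vec_sum_list n gs \<equiv> foldr (+) gs (0\<^sub>v n)"

lemma vec_sum_list_carrier: "set gs \<subseteq> carrier_vec n \<Longrightarrow> vec_sum_list n gs \<in> carrier_vec n"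
  by (induction gs) auto

lemma index_vec_sum_list:
  "set gs \<subseteq> carrier_vec n \<Longrightarrow> i < n \<Longrightarrow> vec_sum_list n gs $ i = (\<Sum>g\<leftarrow>gs. g $ i)"
proof (induction gs)
  case (Cons g gs)
  then show ?case using vec_sum_list_carrier[of gs n] by simp
qed simp

text \<open>The sign of moving the \<open>Z\<close>-part of \<open>g\<close> past everything after
  it, in the form of the first summand of \<open>pair_count\<close>.\<close>

lemma bit_sign_zx_form_vec_sum_list:
  "set gs \<subseteq> carrier_vec (2 * N) \<Longrightarrow>
    bit_sign (zx_form N g (vec_sum_list (2 * N) gs)) = (-1) ^ (\<Sum>h\<leftarrow>gs. of_bool (zx_form N g h = 1))"
proof (induction gs)
  case (Cons h gs)
  then show ?case
    using vec_sum_list_carrier[of gs "2 * N"]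
    by (simp add: zx_form_add_right bit_sign_add power_add)
qed (simp add: zx_form_zero_right)

text \<open>Prepending an observable adds its factors \<open>Y\<close> to the phase and its pairs
  with the later vectors to the sign.\<close>

lemma mat_product_observables:
  assumes "set gs \<subseteq> carrier_vec (2 * N)"
  shows "mat_product N (map (observable N) gs) =
    (\<i> ^ (\<Sum>g\<leftarrow>gs. y_count N g) * (-1) ^ pair_count (zx_form N) gs) \<cdot>\<^sub>m
      weyl N (vec_sum_list (2 * N) gs)"
  using assms
proof (induction gs)
  case Nil
  show ?case by (simp add: mat_product_def weyl_zero one_smult_mat)
next
  case (Cons g gs)
  let ?c = "\<i> ^ (\<Sum>g\<leftarrow>gs. y_count N g) * (-1) ^ pair_count (zx_form N) gs"
  let ?s = "vec_sum_list (2 * N) gs"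
  have gs: "set gs \<subseteq> carrier_vec (2 * N)" and g: "g \<in> carrier_vec (2 * N)"
    using Cons.prems by auto
  have "mat_product N (map (observable N) (g # gs)) = observable N g * (?c \<cdot>\<^sub>m weyl N ?s)"
    using Cons.IH[OF gs] by (simp add: mat_product_def)
  also have "\<dots> = (\<i> ^ y_count N g * ?c * bit_sign (zx_form N g ?s)) \<cdot>\<^sub>m weyl N (g + ?s)"
    unfolding observable_eq_weyl smult_mult_smult_mat[OF weyl_carrier weyl_carrier]
      weyl_mult[OF g vec_sum_list_carrier[OF gs]] smult_smult_mat ..
  finally show ?case
    unfolding bit_sign_zx_form_vec_sum_list[OF gs] by (simp add: power_add mult_ac)
qed

section \<open>Totally isotropic subspaces\<close>

text \<open>Each coordinate is a linear functional, hence equals \<open>1\<close> an even number of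
  times.\<close>

lemma (in bit_subspace) vec_sum_list_eq_zero:
  assumes "4 dvd card U" and "distinct gs" and "set gs = U"
  shows "vec_sum_list n gs = 0\<^sub>v n"
proof (rule eq_vecI)
  fix i assume "i < dim_vec (0\<^sub>v n :: bit vec)"
  then have i: "i < n" by simp
  have "card U dvd 2 * (\<Sum>x\<in>U. of_bool (x $ i = 1))"
    using carrier i by (intro card_dvd_count_linear) (auto simp: subset_iff)
  with assms(1) have "4 dvd 2 * (\<Sum>x\<in>U. of_bool (x $ i = 1) :: nat)"
    by (rule dvd_trans)
  moreover have "even m" if "4 dvd 2 * m" for m :: nat
    using that by presburger
  ultimately have "even (\<Sum>x\<in>U. of_bool (x $ i = 1) :: nat)"
    by blast
  then obtain m where m: "(\<Sum>x\<in>U. of_bool (x $ i = 1) :: nat) = 2 * m" by (elim dvdE)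
  \<comment> \<open>A sum of bits is the number of ones read modulo two.\<close>
  have "(\<Sum>x\<in>U. x $ i) = of_nat (\<Sum>x\<in>U. of_bool (x $ i = 1))"
    unfolding of_nat_sum
  proof (intro sum.cong refl)
    fix x :: "bit vec"
    show "x $ i = of_nat (of_bool (x $ i = 1))" by (cases "x $ i") simp_all
  qed
  also have "\<dots> = 0" unfolding m by simp
  finally show "vec_sum_list n gs $ i = 0\<^sub>v n $ i"
    using i carrier index_vec_sum_list[of gs n i] sum.distinct_set_conv_list[OF assms(2), of "\<lambda>x. x $ i"]
    by (simp add: assms(3))
qed (use vec_sum_list_carrier[of gs n] carrier assms(3) in simp)

text \<open>For a fixed qubit, \<open>Y\<close> occurs where two coordinate functionals are both
  \<open>1\<close>, so on a multiple of a quarter of \<open>U\<close>; the qubits are then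
  summed.\<close>

lemma (in bit_subspace) dvd_sum_y_count:
  assumes "n = 2 * N" and "16 dvd card U"
  shows "4 dvd (\<Sum>g\<in>U. y_count N g)"
proof -
  have "4 dvd (\<Sum>g\<in>U. of_bool (g $ j = 1 \<and> g $ (N + j) = 1) :: nat)" if "j < N" for j
  proof -
    have "card U dvd 4 * (\<Sum>g\<in>U. of_bool (g $ j = 1 \<and> g $ (N + j) = 1))"
      using carrier assms(1) that by (intro card_dvd_count_linear2) (auto simp: subset_iff)
    with assms(2) have "16 dvd 4 * (\<Sum>g\<in>U. of_bool (g $ j = 1 \<and> g $ (N + j) = 1) :: nat)"
      by (rule dvd_trans)
    moreover have "4 dvd m" if "16 dvd 4 * m" for m :: nat
      using that by presburger
    ultimately show ?thesis by blast
  qed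
  then show ?thesis
    unfolding y_count_def by (subst sum.swap) (rule dvd_sum, simp)
qed

text \<open>The enumeration \<open>gs\<close> is arbitrary, matching the demand of
  \<open>has_product\<close> for every order of the factors.\<close>

lemma (in bit_subspace) even_pair_count_zx_form:
  assumes "n = 2 * N" and "16 dvd card U" and "distinct gs" and "set gs = U"
    and symp: "\<And>x y. x \<in> U \<Longrightarrow> y \<in> U \<Longrightarrow> symp_form N x y = 0"
  shows "even (pair_count (zx_form N) gs)"
proof -
  have sym: "zx_form N x y = zx_form N y x" if "x \<in> U" "y \<in> U" for x y
    using symp[OF that] unfolding symp_form_eq_zx_form
    by (cases "zx_form N x y"; cases "zx_form N y x") simp_all
  have left: "zx_form N (x + y) z = zx_form N x z + zx_form N y z"
    and right: "zx_form N z (x + y) = zx_form N z x + zx_form N z y" if "x \<in> U" "y \<in> U" for x y z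
    using carrier that assms(1) by (auto intro: zx_form_add_left zx_form_add_right)
  have cancel: "8 dvd m" if "card U dvd 2 * m" for m
  proof -
    have "16 dvd 2 * m" using assms(2) that by (rule dvd_trans)
    then show ?thesis by presburger
  qed
  have "8 dvd (\<Sum>x\<in>U. of_bool (zx_form N x x = 1) :: nat)"
  proof (intro cancel card_dvd_count_linear)
    fix x y assume "x \<in> U" "y \<in> U"
    \<comment> \<open>By symmetry the two cross terms are equal and cancel, so the diagonal of the
      form is linear on \<open>U\<close>.\<close>
    then show "zx_form N (x + y) (x + y) = zx_form N x x + zx_form N y y"
      using sym[of x y] add[of x y]
      by (cases "zx_form N x x"; cases "zx_form N y y"; cases "zx_form N y x")
        (simp_all add: left right)
  qed
  \<comment> \<open>For fixed \<open>x\<close> the inner sum counts the ones of a linear functional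
    in \<open>y\<close>.\<close>
  moreover have "8 dvd (\<Sum>x\<in>U. \<Sum>y\<in>U. of_bool (zx_form N x y = 1) :: nat)"
    by (intro dvd_sum cancel card_dvd_count_linear right)
  moreover have "2 * pair_count (zx_form N) gs + (\<Sum>x\<in>U. of_bool (zx_form N x x = 1)) =
      (\<Sum>x\<in>U. \<Sum>y\<in>U. of_bool (zx_form N x y = 1))"
    using pair_count_double[of gs "zx_form N"] sym assms(4)
    by (simp add: sum.distinct_set_conv_list[OF assms(3), unfolded assms(4)])
  ultimately have "8 dvd 2 * pair_count (zx_form N) gs"
    by (metis dvd_add_left_iff)
  moreover have "even m" if "8 dvd 2 * m" for m :: nat
    using that by presburger
  ultimately show ?thesis by blast
qed

lemma (in bit_subspace) isotropic_positive:
  assumes n: "n = 2 * N" and card: "16 dvd card U"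
    and symp: "\<And>x y. x \<in> U \<Longrightarrow> y \<in> U \<Longrightarrow> symp_form N x y = 0"
  shows "positive N (observable N ` (U - {0\<^sub>v n}))"
  unfolding positive_def has_product_def
proof (intro conjI allI impI)
  show "finite (observable N ` (U - {0\<^sub>v n}))"
    using finite by simp
  fix Ms assume "distinct Ms \<and> set Ms = observable N ` (U - {0\<^sub>v n})"
  then have Ms: "distinct Ms" "set Ms = observable N ` (U - {0\<^sub>v n})" by auto
  have inj: "inj_on (observable N) U"
    using inj_on_observable carrier n by (metis inj_on_subset)
  \<comment> \<open>Injectivity of \<open>observable\<close> pulls an arbitrary ordering of the
    matrices back to an ordering of the vectors.\<close>
  define hs where "hs = map (inv_into U (observable N)) Ms"
  have map_hs: "map (observable N) hs = Ms"
    unfolding hs_def map_map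
  proof (rule map_idI)
    fix M assume "M \<in> set Ms"
    then have "M \<in> observable N ` U" unfolding Ms(2) by auto
    then show "(observable N \<circ> inv_into U (observable N)) M = M"
      by (simp add: f_inv_into_f)
  qed
  have set_hs: "set hs = U - {0\<^sub>v n}"
    unfolding hs_def set_map Ms(2) using inj by (simp add: inv_into_image_cancel)
  have "distinct hs"
    using Ms(1) unfolding map_hs[symmetric] by (simp add: distinct_map)
  \<comment> \<open>The zero vector, whose observable is the identity, is put back so that the
    counts over all of \<open>U\<close> apply.\<close>
  define gs where "gs = 0\<^sub>v n # hs"
  have gs: "distinct gs" "set gs = U"
    using \<open>distinct hs\<close> set_hs zero by (auto simp: gs_def)
  have "(\<Sum>g\<leftarrow>gs. y_count N g) = (\<Sum>g\<in>U. y_count N g)"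
    using sum.distinct_set_conv_list[OF gs(1)] gs(2) by metis
  then obtain a where a: "(\<Sum>g\<leftarrow>gs. y_count N g) = 4 * a"
    using dvd_sum_y_count[OF n card] by auto
  obtain b where b: "pair_count (zx_form N) gs = 2 * b"
    using even_pair_count_zx_form[OF n card gs symp] by auto
  have "4 dvd card U" using card by (rule dvd_trans[rotated]) simp
  have "\<i> ^ (4 * a) = 1"
    unfolding power_mult by (simp add: eval_nat_numeral)
  moreover have "set gs \<subseteq> carrier_vec (2 * N)"
    using carrier n gs by simp
  ultimately have "mat_product N (map (observable N) gs) = 1\<^sub>m (2 ^ N)"
    using vec_sum_list_eq_zero[OF \<open>4 dvd card U\<close> gs] n
    by (simp add: mat_product_observables a b weyl_zero one_smult_mat)
  moreover have "mat_product N (map (observable N) gs) = mat_product N Ms"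
  proof -
    \<comment> \<open>The size of the product is what allows the leading identity matrix to be
      cancelled.\<close>
    have "mat_product N Ms \<in> carrier_mat (2 ^ N) (2 ^ N)"
      using mat_product_observables[of hs N] set_hs carrier n weyl_carrier[of N]
      unfolding map_hs[symmetric] by (metis Diff_subset order_trans smult_carrier_mat)
    then show ?thesis
      using map_hs n by (simp add: gs_def mat_product_def observable_zero)
  qed
  ultimately show "mat_product N Ms = 1\<^sub>m (2 ^ N)" by simp
qed

section \<open>The configuration of all totally isotropic subspaces\<close>

lemma finite_points: "finite (points N)"
  unfolding points_def using finite_carrier_vec_bit by auto

lemma totally_isotropic_subspace_positive:
  assumes "k \<ge> 3" and "totally_isotropic_subspace N k S"
  shows "positive N (observable N ` S)"
proof -
  obtain U where U: "VectorSpace.subspace class_ring U (module_vec TYPE(bit) (2 * N))"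
    "vectorspace.dim class_ring ((module_vec TYPE(bit) (2 * N))\<lparr>carrier := U\<rparr>) = k + 1"
    "\<forall>x\<in>U. \<forall>y\<in>U. symp_form N x y = 0" "S = U - {0\<^sub>v (2 * N)}"
    using assms(2) unfolding totally_isotropic_subspace_def by auto
  interpret bit_subspace "2 * N" U
    using U(1) by (rule subspace_bit_subspace)
  have "card U = 2 ^ (k + 1)"
    using subspace_bit_subspace(2)[OF U(1)] U(2) by simp
  \<comment> \<open>Projective dimension at least \<open>3\<close> means vector space dimension at
    least \<open>4\<close>.\<close>
  then have "2 ^ 4 dvd card U"
    using assms(1) by (simp only:) (intro le_imp_power_dvd, simp)
  then show ?thesis
    unfolding U(4) using U(3) by (intro isotropic_positive) auto
qed

lemma totally_isotropic_subspaceD: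
  assumes "totally_isotropic_subspace N k S"
  shows "S \<subseteq> points N" and "x \<in> S \<Longrightarrow> y \<in> S \<Longrightarrow> symp_form N x y = 0"
proof -
  obtain U where U: "VectorSpace.subspace class_ring U (module_vec TYPE(bit) (2 * N))"
    "\<forall>x\<in>U. \<forall>y\<in>U. symp_form N x y = 0" "S = U - {0\<^sub>v (2 * N)}"
    using assms unfolding totally_isotropic_subspace_def by auto
  show "S \<subseteq> points N"
    using bit_subspace.carrier[OF subspace_bit_subspace(1)[OF U(1)]] U(3)
    by (auto simp: points_def)
  show "x \<in> S \<Longrightarrow> y \<in> S \<Longrightarrow> symp_form N x y = 0"
    using U(2,3) by auto
qed

text \<open>A finite context has an enumeration, so the two requirements meet in one product; the
  identity and its negative differ at entry \<open>(0, 0)\<close>.\<close>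

lemma positive_not_negative:
  assumes "positive N c"
  shows "\<not> negative N c"
proof
  assume "negative N c"
  moreover obtain Ms where "distinct Ms" "set Ms = c"
    using assms finite_distinct_list unfolding positive_def has_product_def by metis
  ultimately have "1\<^sub>m (2 ^ N) = (- 1\<^sub>m (2 ^ N) :: complex mat)"
    using assms unfolding positive_def negative_def has_product_def by metis
  then have "1\<^sub>m (2 ^ N) $$ (0, 0) = (- 1\<^sub>m (2 ^ N) :: complex mat) $$ (0, 0)"
    by (rule arg_cong)
  then show False by simp
qed

theorem proposition3:
  fixes N k :: nat
  assumes "k \<ge> 3" and "N > k"
  shows "(\<forall>S. totally_isotropic_subspace N k S \<longrightarrow> positive N (observable N ` S)) \<and>
    quantum_configuration N (observable N ` points N)
      {observable N ` S | S. totally_isotropic_subspace N k S} \<and>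
    \<not> contextual N (observable N ` points N)
      {observable N ` S | S. totally_isotropic_subspace N k S}"
proof (intro conjI)
  let ?C = "{observable N ` S | S. totally_isotropic_subspace N k S}"
  show pos: "\<forall>S. totally_isotropic_subspace N k S \<longrightarrow> positive N (observable N ` S)"
    using totally_isotropic_subspace_positive[OF assms(1)] by blast
  have sub: "c \<subseteq> observable N ` points N" if "c \<in> ?C" for c
    using that totally_isotropic_subspaceD(1) by blast
  \<comment> \<open>Contexts are subsets of the finite set of all observables.\<close>
  have fin: "finite ?C"
    by (rule finite_subset[of _ "Pow (observable N ` points N)"])
      (use sub finite_points in auto)
  have obs: "\<forall>M\<in>observable N ` points N. M \<in> carrier_mat (2 ^ N) (2 ^ N) \<and>
      mat_adjoint M = M \<and> M * M = 1\<^sub>m (2 ^ N)"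
    by (auto simp: points_def observable_carrier mat_adjoint_observable observable_square)
  have pos_C: "positive N c" if "c \<in> ?C" for c
    using that pos by blast
  have comm: "M * M' = M' * M" if c: "c \<in> ?C" and M: "M \<in> c" "M' \<in> c" for c M M'
  proof -
    obtain S g h where S: "totally_isotropic_subspace N k S" "g \<in> S" "h \<in> S"
      and M_eq: "M = observable N g" "M' = observable N h"
      using c M by auto
    then have "g \<in> carrier_vec (2 * N)" "h \<in> carrier_vec (2 * N)"
      using totally_isotropic_subspaceD(1)[OF S(1)] by (auto simp: points_def)
    then show ?thesis
      unfolding M_eq using totally_isotropic_subspaceD(2)[OF S]
      by (simp add: observable_commutation[of g N h] one_smult_mat)
  qed
  show "quantum_configuration N (observable N ` points N) ?C"
    unfolding quantum_configuration_def
    by (intro conjI obs finite_imageI finite_points fin; intro ballI disjI1; (rule sub comm pos_C; assumption))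
  have "valuation N c = 0" if "c \<in> ?C" for c
    using positive_not_negative[OF pos_C[OF that]] by (simp add: valuation_def)
  \<comment> \<open>With a zero valuation vector the system is homogeneous, so the zero assignment
    solves it.\<close>
  then have "\<forall>c\<in>?C. (\<Sum>M\<in>observable N ` points N. incidence c M * 0) = valuation N c"
    by simp
  then show "\<not> contextual N (observable N ` points N) ?C"
    unfolding contextual_def not_not by (rule exI[where x = "\<lambda>_. 0"])
qed

end
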